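(* We have $$\frac{(1-t)(1+t\exp_{q}(x))}{1-t^{2}\exp_{q}(x)\mathrm{Exp}_{q}(x)}=1+\frac{1+t}{2}\sum_{n=1}^{\infty}\left(\frac{1+t^{2}}{1-t^{2}}\right)^{n}P_{n}^{(\mathrm{inv},\mathrm{udr})}\left(q,\frac{2t}{1+t^{2}}\right)\frac{x^{n}}{[n]_{q}!}.$$ Equivalently, $$\sum_{n=1}^{\infty}P_{n}^{(\mathrm{inv},\mathrm{udr})}(q,t)\frac{x^{n}}{[n]_{q}!}=\frac{2}{1+v}\left(\frac{(1-v)\left(1+v\exp_{q}\left(\frac{1-v^{2}}{1+v^{2}}x\right)\right)}{1-v^{2}\exp_{q}\left(\frac{1-v^{2}}{1+v^{2}}x\right)\mathrm{Exp}_{q}\left(\frac{1-v^{2}}{1+v^{2}}x\right)}-1\right),$$ where $v=\frac{1-\sqrt{1-t^{2}}}{t}$.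
   Context: $\mathfrak{S}_n$ is the set of permutations $\pi=\pi_1\cdots\pi_n$ of $[n]=\{1,\dots,n\}$. For $\pi\in\mathfrak{S}_n$, $\mathrm{inv}(\pi)$ is the number of pairs $(i,j)$ with $1\le i<j\le n$ and $\pi_i>\pi_j$. An increasing run of $\pi$ is a maximal increasing consecutive subsequence. A birun of $\pi$ is a maximal monotone (increasing or decreasing) consecutive subsequence of length at least two. An up-down run of $\pi$ is either a birun of $\pi$, or the letter $\pi_1$ if it is an increasing run of length $1$; $\mathrm{udr}(\pi)$ is the number of up-down runs of $\pi$. For $n\ge1$, $P_n^{(\mathrm{inv},\mathrm{udr})}(q,t)=\sum_{\pi\in\mathfrak{S}_n}q^{\mathrm{inv}(\pi)}t^{\mathrm{udr}(\pi)}$. Also $[n]_q!=(1+q)(1+q+q^2)\cdots(1+q+\cdots+q^{n-1})$ (with $[0]_q!=[1]_q!=1$), $\exp_q(x)=\sum_{n\ge0}\frac{x^n}{[n]_q!}$ and $\mathrm{Exp}_q(x)=\sum_{n\ge0}q^{\binom n2}\frac{x^n}{[n]_q!}$. Here $q,t,x$ are indeterminates and the identities are identities of formal power series in $x$: in the first, coefficients are rational functions of $q,t$; in the second, coefficients are formal power series in $t$ over $\mathbb{Q}(q)$, where $\sqrt{1-t^2}$ is the power series in $t$ with constant term $1$, so that $v$ is a formal power series in $t$. *)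

theory Defs
  imports "HOL-Computational_Algebra.Formal_Power_Series"
    "HOL-Computational_Algebra.Polynomial"
    "HOL-Computational_Algebra.Fraction_Field" "HOL-Combinatorics.Permutations"
begin

text \<open>
  A permutation of \<open>{1..n}\<close> is a function \<open>\<pi>\<close> with \<open>\<pi> permutes {1..n}\<close>.
  A consecutive subsequence \<open>\<pi> i, \<dots>, \<pi> j\<close> is represented by its set of positions \<open>{i..j}\<close>.
\<close>

definition perm_inv :: "nat \<Rightarrow> (nat \<Rightarrow> nat) \<Rightarrow> nat" where
  "perm_inv n \<pi> = card {(i, j). 1 \<le> i \<and> i < j \<and> j \<le> n \<and> \<pi> i > \<pi> j}"

definition segments :: "nat \<Rightarrow> nat set set" where
  "segments n = {{i..j} | i j. 1 \<le> i \<and> i \<le> j \<and> j \<le> n}"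

definition maximal_segments :: "nat \<Rightarrow> (nat set \<Rightarrow> bool) \<Rightarrow> nat set set" where
  "maximal_segments n Q =
     {I \<in> segments n. Q I \<and> (\<forall>J \<in> segments n. Q J \<and> I \<subseteq> J \<longrightarrow> J = I)}"

definition increasing_runs :: "nat \<Rightarrow> (nat \<Rightarrow> nat) \<Rightarrow> nat set set" where
  "increasing_runs n \<pi> = maximal_segments n (\<lambda>I. strict_mono_on I \<pi>)"

definition biruns :: "nat \<Rightarrow> (nat \<Rightarrow> nat) \<Rightarrow> nat set set" where
  "biruns n \<pi> =
     {I \<in> maximal_segments n (\<lambda>I. strict_mono_on I \<pi> \<or> strict_antimono_on I \<pi>). card I \<ge> 2}"

definition up_down_runs :: "nat \<Rightarrow> (nat \<Rightarrow> nat) \<Rightarrow> nat set set" where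
  "up_down_runs n \<pi> = biruns n \<pi> \<union> {I \<in> increasing_runs n \<pi>. I = {1}}"

definition udr :: "nat \<Rightarrow> (nat \<Rightarrow> nat) \<Rightarrow> nat" where
  "udr n \<pi> = card (up_down_runs n \<pi>)"

definition P_inv_udr :: "nat \<Rightarrow> 'a::comm_semiring_1 \<Rightarrow> 'a \<Rightarrow> 'a" where
  "P_inv_udr n q t = (\<Sum>\<pi> | \<pi> permutes {1..n}. q ^ perm_inv n \<pi> * t ^ udr n \<pi>)"

text \<open>
  The coefficient ring need not be a field: it is also instantiated with the ring of power
  series over a field, where the \<open>q\<close>-factorials of a constant \<open>q\<close> are constants.
\<close>

definition q_fact :: "'a::comm_semiring_1 \<Rightarrow> nat \<Rightarrow> 'a" where
  "q_fact q n = (\<Prod>k = 1..n. \<Sum>i<k. q ^ i)"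

definition exp_q :: "'a::{idom_divide,inverse} \<Rightarrow> 'a fps" where
  "exp_q q = Abs_fps (\<lambda>n. 1 / q_fact q n)"

definition Exp_q :: "'a::{idom_divide,inverse} \<Rightarrow> 'a fps" where
  "Exp_q q = Abs_fps (\<lambda>n. q ^ (n choose 2) / q_fact q n)"

text \<open>The field \<open>\<rat>(q, t)\<close> is the type \<open>rat poly poly fract\<close>; the inner variable is \<open>q\<close>.\<close>

definition q_rat :: "rat poly poly fract" where
  "q_rat = Fract [:[:0, 1:]:] 1"

definition t_rat :: "rat poly poly fract" where
  "t_rat = Fract [:0, 1:] 1"

text \<open>The ring \<open>\<rat>(q)[[t]]\<close> is the type \<open>rat poly fract fps\<close>.\<close>

definition q_ser :: "rat poly fract fps" where
  "q_ser = fps_const (Fract [:0, 1:] 1)"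

definition t_ser :: "rat poly fract fps" where
  "t_ser = fps_X"

text \<open>
  The first argument of \<^const>\<open>fps_radical\<close> selects the root taken of the constant term, which
  is \<open>1\<close> here.
\<close>

definition sqrt_ser :: "rat poly fract fps" where
  "sqrt_ser = fps_radical (\<lambda>_ _. 1) 2 (1 - t_ser ^ 2)"

definition v_ser :: "rat poly fract fps" where
  "v_ser = (1 - sqrt_ser) / t_ser"

text \<open>Division by \<open>t\<close> in power series drops a nonzero constant term; \<open>t_times_v_ser\<close> below
  shows that none occurs in \<open>v_ser\<close>.\<close>

instance fract :: ("{idom,ring_char_0}") field_char_0
proof
  show "inj (of_nat :: nat \<Rightarrow> 'a fract)"
    by (simp add: inj_on_def of_nat_fract eq_fract)
qed

lemma sqrt_ser_square: "sqrt_ser ^ 2 = 1 - t_ser ^ 2"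
  and sqrt_ser_nth_0: "fps_nth sqrt_ser 0 = 1"
proof -
  have "fps_nth (1 - t_ser ^ 2) 0 = 1"
    by (simp add: t_ser_def power2_eq_square)
  then show "sqrt_ser ^ 2 = 1 - t_ser ^ 2"
    using power_radical[of "1 - t_ser ^ 2" "\<lambda>_ _. 1" 1]
    by (simp add: sqrt_ser_def numeral_2_eq_2)
  show "fps_nth sqrt_ser 0 = 1"
    by (simp add: sqrt_ser_def)
qed

lemma t_times_v_ser: "t_ser * v_ser = 1 - sqrt_ser"
proof -
  have "subdegree (1 - sqrt_ser) \<ge> subdegree t_ser" if "1 - sqrt_ser \<noteq> 0"
    by (rule subdegree_geI) (use that sqrt_ser_nth_0 in \<open>auto simp: t_ser_def\<close>)
  then have "t_ser dvd 1 - sqrt_ser"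
    by (cases "1 - sqrt_ser = 0") (simp_all add: fps_dvd_iff t_ser_def)
  then show ?thesis
    by (simp add: v_ser_def)
qed

text \<open>
  Division of series in \<open>x\<close> over \<open>\<rat>(q)[[t]]\<close> is exact when the constant coefficient of the
  denominator is itself invertible.
\<close>

lemma fps_fps_divide_times:
  fixes f g :: "'a::field fps fps"
  assumes "fps_nth (fps_nth g 0) 0 \<noteq> 0"
  shows "f / g * g = f"
proof -
  have "fps_nth g 0 * inverse (fps_nth g 0) = 1"
    using assms by (rule inverse_mult_eq_1')
  then have *: "g * inverse g = 1"
    unfolding fps_inverse_def by (rule fps_right_inverse)
  have "fps_nth g 0 \<noteq> 0"
    using assms by auto
  then have **: "f / g = f * inverse g"
    by (simp add: fps_divide_def)
  have "f / g * g = f * (g * inverse g)"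
    unfolding ** by (simp only: mult_ac)
  then show ?thesis
    by (simp only: * mult_1_right)
qed

end

theory Submission
  imports Defs
begin

text \<open>
  With \<open>E = exp_q x\<close> and \<open>F = Exp_q x\<close>, expanding the quotient in powers of \<open>t\<close> gives the
  alternating products \<open>E F E F \<dots>\<close>, which count permutations cut into possibly empty segments
  that alternately increase and decrease.  For a fixed permutation these cuts are enumerated by a
  two-state transfer matrix (parity of the current segment), and after each letter the two entries
  are in ratio \<open>1 : t\<close> or \<open>t : 1\<close> according to the direction of the last step.  Hence the weight
  is multiplicative: a step in the previous direction contributes \<open>u = (1 + t\<^sup>2) / (1 - t\<^sup>2)\<close> and a
  change of direction contributes \<open>d = 2 t / (1 - t\<^sup>2)\<close>.

  To avoid infinite sums in \<open>t\<close>, let \<open>e + 1\<close> and \<open>o\<close> be twice the generating functions, in closed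
  form, of the cuts into an even and an odd number of segments.  They are characterized by
  \<open>o = t (e + 1) E\<close> and \<open>e - 1 = t o F\<close>.  As
  \<open>F\<close> is the inverse of \<open>exp_q (- x)\<close>, both only require splitting off an increasing tail, and in
  terms of inversion tables this factorizes: such tails are partitions in a box.
  Only \<open>u = 1 + t d\<close> and \<open>d = t (1 + u)\<close> are needed, so the same argument
  serves \<open>\<rat>(q, t)\<close> and, with \<open>v\<close> for \<open>t\<close>, the ring \<open>\<rat>(q)[[t]]\<close>.
\<close>

section \<open>Inversion tables\<close>

text \<open>
  A code lists the most recent letter first: in \<open>x # a\<close> the number \<open>x\<close> counts the earlier
  letters exceeding the current one.  The last step is an ascent iff that number did not grow.
  The conventions for short lists make the initial letter an ascent that starts a new run.
\<close>

primrec codes :: "nat \<Rightarrow> nat list set" where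
  "codes 0 = {[]}"
| "codes (Suc n) = (\<lambda>(x, a). x # a) ` ({..n} \<times> codes n)"

fun ascent_last :: "nat list \<Rightarrow> bool" where
  "ascent_last [] = False"
| "ascent_last [x] = True"
| "ascent_last (x # y # a) = (x \<le> y)"

primrec code_runs :: "nat list \<Rightarrow> nat" where
  "code_runs [] = 0"
| "code_runs (x # a) = code_runs a + (if ascent_last (x # a) = ascent_last a then 0 else 1)"

lemma length_codes: "a \<in> codes n \<Longrightarrow> length a = n"
  by (induction n arbitrary: a) auto

lemma finite_codes [simp]: "finite (codes n)"
  by (induction n) auto

lemma card_codes: "card (codes n) = fact n"
proof (induction n)
  case (Suc n)
  have "inj_on (\<lambda>(x, a). x # a) ({..n} \<times> codes n)"
    by (auto simp: inj_on_def)
  then show ?case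
    using Suc by (simp add: card_image card_cartesian_product del: mult_Suc)
qed simp

lemma Cons_in_codes: "x # a \<in> codes (Suc n) \<longleftrightarrow> x \<le> n \<and> a \<in> codes n"
  by auto

lemma code_runs_le: "code_runs a \<le> length a"
  by (induction a) auto

section \<open>The inversion table of a permutation\<close>

primrec perm_code :: "(nat \<Rightarrow> nat) \<Rightarrow> nat \<Rightarrow> nat list" where
  "perm_code \<pi> 0 = []"
| "perm_code \<pi> (Suc n) = card {l \<in> {1..n}. \<pi> l > \<pi> (Suc n)} # perm_code \<pi> n"

lemma perm_code_in_codes: "perm_code \<pi> n \<in> codes n"
proof (induction n)
  case (Suc n)
  have "card {l \<in> {1..n}. \<pi> l > \<pi> (Suc n)} \<le> card {1..n}"
    by (rule card_mono) auto
  then show ?case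
    using Suc by (auto simp del: codes.simps simp: Cons_in_codes)
qed simp

lemma sum_list_perm_code: "sum_list (perm_code \<pi> n) = perm_inv n \<pi>"
proof (induction n)
  case 0
  have "{(i, j). 1 \<le> i \<and> i < j \<and> j \<le> (0::nat) \<and> \<pi> i > \<pi> j} = {}"
    by auto
  then show ?case
    by (simp only: perm_inv_def) simp
next
  case (Suc n)
  let ?I = "\<lambda>n. {(i, j). 1 \<le> i \<and> i < j \<and> j \<le> n \<and> \<pi> i > \<pi> j}"
  let ?N = "(\<lambda>l. (l, Suc n)) ` {l \<in> {1..n}. \<pi> l > \<pi> (Suc n)}"
  have "?I (Suc n) = ?I n \<union> ?N"
    by (auto simp: le_Suc_eq)
  moreover have "finite (?I n)"
    by (rule finite_subset[of _ "{1..n} \<times> {1..n}"]) auto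
  moreover have "?I n \<inter> ?N = {}"
    by auto
  ultimately have "perm_inv (Suc n) \<pi> = perm_inv n \<pi> + card ?N"
    unfolding perm_inv_def by (simp add: card_Un_disjoint)
  also have "card ?N = card {l \<in> {1..n}. \<pi> l > \<pi> (Suc n)}"
    by (rule card_image) (auto simp: inj_on_def)
  finally show ?case
    using Suc by simp
qed

lemma perm_code_eqD:
  assumes "perm_code \<pi> n = perm_code \<sigma> n" "1 \<le> j" "j \<le> n"
  shows "card {l \<in> {1..<j}. \<pi> l > \<pi> j} = card {l \<in> {1..<j}. \<sigma> l > \<sigma> j}"
  using assms by (induction n) (auto simp: le_Suc_eq less_Suc_eq_le)

text \<open>Let \<open>j\<close> be the last position where the two permutations differ. To its
  right they agree, so positions \<open>1..j\<close> carry the same set of values in both. Inside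
  that set a value is determined by how many elements exceed it, and this number is the code entry
  at \<open>j\<close>.\<close>

lemma perm_code_inj: "inj_on (\<lambda>\<pi>. perm_code \<pi> n) {\<pi>. \<pi> permutes {1..n}}"
proof (rule inj_onI, rule ccontr)
  fix \<pi> \<sigma>
  assume "\<pi> \<in> {\<pi>. \<pi> permutes {1..n}}" "\<sigma> \<in> {\<pi>. \<pi> permutes {1..n}}"
    and eq: "perm_code \<pi> n = perm_code \<sigma> n" and "\<pi> \<noteq> \<sigma>"
  then have \<pi>: "\<pi> permutes {1..n}" and \<sigma>: "\<sigma> permutes {1..n}"
    by auto
  define j where "j = Max {j \<in> {1..n}. \<pi> j \<noteq> \<sigma> j}"
  have "\<exists>j. \<pi> j \<noteq> \<sigma> j"
    using \<open>\<pi> \<noteq> \<sigma>\<close> by blast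
  then have "\<exists>j \<in> {1..n}. \<pi> j \<noteq> \<sigma> j"
    using \<pi> \<sigma> by (metis permutes_not_in)
  then have ne: "{j \<in> {1..n}. \<pi> j \<noteq> \<sigma> j} \<noteq> {}"
    by blast
  have j: "j \<in> {1..n}" "\<pi> j \<noteq> \<sigma> j"
    using Max_in[OF _ ne] unfolding j_def by auto
  have agree: "\<pi> i = \<sigma> i" if "j < i" for i
  proof (cases "i \<le> n")
    case True
    then show ?thesis
      using that j Max_ge[of "{j \<in> {1..n}. \<pi> j \<noteq> \<sigma> j}" i] unfolding j_def[symmetric]
      by force
  next
    case False
    then show ?thesis
      using \<pi> \<sigma> by (simp add: permutes_not_in)
  qed
  have image: "\<tau> ` {1..j} = {1..n} - \<tau> ` {j<..n}" if "\<tau> permutes {1..n}" for \<tau>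
  proof -
    have "{1..j} = {1..n} - {j<..n}"
      using j by auto
    then show ?thesis
      using that by (simp add: image_set_diff permutes_inj permutes_image)
  qed
  have "\<pi> ` {j<..n} = \<sigma> ` {j<..n}"
    using agree by (intro image_cong) auto
  then have V: "\<pi> ` {1..j} = \<sigma> ` {1..j}"
    using image \<pi> \<sigma> by simp
  have card_above: "card {v \<in> \<tau> ` {1..j}. v > \<tau> j} = card {l \<in> {1..<j}. \<tau> l > \<tau> j}"
    if "\<tau> permutes {1..n}" for \<tau>
  proof -
    have "{v \<in> \<tau> ` {1..j}. v > \<tau> j} = \<tau> ` {l \<in> {1..<j}. \<tau> l > \<tau> j}"
      by (auto simp: le_less)
    then show ?thesis
      using card_image[OF inj_on_subset[OF permutes_inj[OF that] subset_UNIV]] by simp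
  qed
  have count_eq: "card {v \<in> \<pi> ` {1..j}. v > \<pi> j} = card {v \<in> \<pi> ` {1..j}. v > \<sigma> j}"
    using card_above[OF \<pi>] card_above[OF \<sigma>] V perm_code_eqD[OF eq, of j] j by simp
  \<comment> \<open>Within a fixed finite set, a smaller member has strictly more elements above it,
    so equal counts force equal values.\<close>
  have count_less: "card {v \<in> W. v > y} < card {v \<in> W. v > x}"
    if "x < y" "y \<in> W" "finite W" for x y :: nat and W
    using that by (intro psubset_card_mono) auto
  have "\<sigma> j \<in> \<pi> ` {1..j}"
    unfolding V using j by auto
  moreover have "\<pi> j \<in> \<pi> ` {1..j}"
    using j by auto
  ultimately have "\<not> \<pi> j < \<sigma> j" "\<not> \<sigma> j < \<pi> j"
    using count_less[of "\<pi> j" "\<sigma> j" "\<pi> ` {1..j}"]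
      count_less[of "\<sigma> j" "\<pi> j" "\<pi> ` {1..j}"] count_eq by auto
  then show False
    using j(2) by simp
qed

text \<open>Surjectivity is by counting: the image lies in \<open>codes n\<close>, and both have
  \<open>fact n\<close> elements.\<close>

lemma bij_betw_perm_code: "bij_betw (\<lambda>\<pi>. perm_code \<pi> n) {\<pi>. \<pi> permutes {1..n}} (codes n)"
  unfolding bij_betw_def
proof
  show "(\<lambda>\<pi>. perm_code \<pi> n) ` {\<pi>. \<pi> permutes {1..n}} = codes n"
  proof (rule card_subset_eq)
    show "card ((\<lambda>\<pi>. perm_code \<pi> n) ` {\<pi>. \<pi> permutes {1..n}}) = card (codes n)"
      by (simp only: card_image[OF perm_code_inj] card_codes card_permutations[OF refl] card_atLeastAtMost
        finite_atLeastAtMost diff_Suc_1)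
  qed (use perm_code_in_codes in auto)
qed (rule perm_code_inj)

text \<open>After an ascent, every earlier letter above the new one is also above the previous one.
  After a descent, all letters above the previous one still count, and the previous one joins them,
  so the count grows strictly.\<close>

lemma ascent_last_perm_code:
  assumes "\<pi> permutes {1..n}" "Suc (Suc j) \<le> n"
  shows "ascent_last (perm_code \<pi> (Suc (Suc j))) \<longleftrightarrow> \<pi> (Suc j) < \<pi> (Suc (Suc j))"
proof (cases "\<pi> (Suc j) < \<pi> (Suc (Suc j))")
  case True
  then have "{l \<in> {1..Suc j}. \<pi> l > \<pi> (Suc (Suc j))} \<subseteq> {l \<in> {1..j}. \<pi> l > \<pi> (Suc j)}"
    by (auto simp: le_Suc_eq)
  then show ?thesis
    using True by (auto intro!: card_mono)
next
  case False
  have "\<pi> (Suc j) \<noteq> \<pi> (Suc (Suc j))"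
    using permutes_inj[OF assms(1)] by (simp add: inj_eq)
  with False have "\<pi> (Suc j) > \<pi> (Suc (Suc j))"
    by simp
  then have "{l \<in> {1..j}. \<pi> l > \<pi> (Suc j)} \<subset> {l \<in> {1..Suc j}. \<pi> l > \<pi> (Suc (Suc j))}"
    by force
  then have "card {l \<in> {1..j}. \<pi> l > \<pi> (Suc j)} < card {l \<in> {1..Suc j}. \<pi> l > \<pi> (Suc (Suc j))}"
    by (intro psubset_card_mono) auto
  then show ?thesis
    using False by simp
qed

lemma code_runs_perm_code:
  "code_runs (perm_code \<pi> n) =
     card {j \<in> {1..n}. ascent_last (perm_code \<pi> j) \<noteq> ascent_last (perm_code \<pi> (j - 1))}"
proof (induction n)
  case (Suc n)
  have "{j \<in> {1..Suc n}. P j} = (if P (Suc n) then insert (Suc n) else id) {j \<in> {1..n}. P j}" for P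
    by (auto simp: le_Suc_eq)
  from this[of "\<lambda>j. ascent_last (perm_code \<pi> j) \<noteq> ascent_last (perm_code \<pi> (j - 1))"] show ?case
    using Suc by simp
qed simp


section \<open>Up-down runs\<close>

lemma strict_mono_on_segment_iff:
  fixes f :: "nat \<Rightarrow> nat"
  shows "strict_mono_on {i..j} f \<longleftrightarrow> (\<forall>k \<in> {i..<j}. f k < f (Suc k))"
proof
  assume "\<forall>k \<in> {i..<j}. f k < f (Suc k)"
  then have "f r < f s" if "i \<le> r" "r < s" "s \<le> j" for r s
    using that(2,3)
  proof (induction s rule: less_induct)
    case (less s)
    then obtain s' where s: "s = Suc s'"
      by (cases s) auto
    then have "f s' < f s"
      using less that(1) by auto
    moreover have "f r \<le> f s'"
      using less s by (cases "r = s'") (auto simp: less_Suc_eq intro: less_imp_le)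
    ultimately show ?case
      by simp
  qed
  then show "strict_mono_on {i..j} f"
    by (auto intro!: strict_mono_onI)
qed (auto simp: strict_mono_on_def)

lemma strict_antimono_on_segment_iff:
  fixes f :: "nat \<Rightarrow> nat"
  shows "strict_antimono_on {i..j} f \<longleftrightarrow> (\<forall>k \<in> {i..<j}. f (Suc k) < f k)"
proof
  assume "\<forall>k \<in> {i..<j}. f (Suc k) < f k"
  then have "f s < f r" if "i \<le> r" "r < s" "s \<le> j" for r s
    using that(2,3)
  proof (induction s rule: less_induct)
    case (less s)
    then obtain s' where s: "s = Suc s'"
      by (cases s) auto
    then have "f s < f s'"
      using less that(1) by auto
    moreover have "f s' \<le> f r"
      using less s by (cases "r = s'") (auto simp: less_Suc_eq intro: less_imp_le)
    ultimately show ?case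
      by simp
  qed
  then show "strict_antimono_on {i..j} f"
    by (auto simp: monotone_on_def)
qed (auto simp: monotone_on_def)

text \<open>By injectivity every step goes strictly up or strictly down, so monotonicity means that
  all steps share one direction.\<close>

lemma monotone_segment_iff:
  assumes "\<pi> permutes {1..n}"
  shows "strict_mono_on {i..j} \<pi> \<or> strict_antimono_on {i..j} \<pi> \<longleftrightarrow>
    (\<forall>k l. i \<le> k \<and> k < j \<and> i \<le> l \<and> l < j \<longrightarrow> (\<pi> k < \<pi> (Suc k) \<longleftrightarrow> \<pi> l < \<pi> (Suc l)))"
proof -
  have "\<not> \<pi> k < \<pi> (Suc k) \<longleftrightarrow> \<pi> (Suc k) < \<pi> k" for k
    using permutes_inj[OF assms] by (metis inj_eq linorder_neqE_nat n_not_Suc_n not_less_iff_gr_or_eq)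
  then show ?thesis
    unfolding strict_mono_on_segment_iff strict_antimono_on_segment_iff
    by (metis atLeastLessThan_iff)
qed

text \<open>Biruns are counted by their left ends via \<open>Min\<close>: a birun can start at
  \<open>i < n\<close> exactly when no step precedes \<open>i\<close> or the direction changes
  there.\<close>

lemma card_biruns:
  assumes \<pi>: "\<pi> permutes {1..n}"
  shows "card (biruns n \<pi>) =
    card {i. 1 \<le> i \<and> i < n \<and> (i = 1 \<or> (\<pi> (i - 1) < \<pi> i) \<noteq> (\<pi> i < \<pi> (Suc i)))}"
    (is "_ = card ?S")
proof -
  define Q where "Q = (\<lambda>I. strict_mono_on I \<pi> \<or> strict_antimono_on I \<pi>)"
  have Q_iff: "Q {i..j} \<longleftrightarrow>
      (\<forall>k l. i \<le> k \<and> k < j \<and> i \<le> l \<and> l < j \<longrightarrow> (\<pi> k < \<pi> (Suc k) \<longleftrightarrow> \<pi> l < \<pi> (Suc l)))" for i j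
    unfolding Q_def by (rule monotone_segment_iff[OF \<pi>])
  have Min_segment: "Min {i..j} = i" if "i \<le> j" for i j :: nat
    using that by (intro Min_eqI) auto
  have birunsD: "\<exists>i j. I = {i..j} \<and> 1 \<le> i \<and> i < j \<and> j \<le> n \<and> Q {i..j} \<and>
      (\<forall>i' j'. 1 \<le> i' \<and> i' \<le> i \<and> j \<le> j' \<and> j' \<le> n \<and> Q {i'..j'} \<longrightarrow> i' = i \<and> j' = j)"
    if I: "I \<in> biruns n \<pi>" for I
  proof -
    from I obtain i j where ij: "I = {i..j}" "1 \<le> i" "i \<le> j" "j \<le> n"
      by (auto simp: biruns_def maximal_segments_def segments_def)
    have "i < j"
      using I ij by (auto simp: biruns_def)
    moreover have "Q {i..j}"
      using I ij unfolding biruns_def maximal_segments_def Q_def by blast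
    moreover have "i' = i \<and> j' = j"
      if "1 \<le> i'" "i' \<le> i" "j \<le> j'" "j' \<le> n" "Q {i'..j'}" for i' j'
    proof -
      have "{i'..j'} \<in> segments n"
        using that ij unfolding segments_def by force
      moreover have "I \<subseteq> {i'..j'}"
        using that ij by auto
      ultimately have "{i'..j'} = I"
        using I that(5) unfolding biruns_def maximal_segments_def Q_def by blast
      then show ?thesis
        using ij by (simp add: Icc_eq_Icc)
    qed
    ultimately show ?thesis
      using ij by blast
  qed
  have birunsI: "{i..j} \<in> biruns n \<pi>"
    if "1 \<le> i" "i < j" "j \<le> n" "Q {i..j}"
      and max: "\<And>i' j'. 1 \<le> i' \<Longrightarrow> i' \<le> i \<Longrightarrow> j \<le> j' \<Longrightarrow> j' \<le> n \<Longrightarrow> Q {i'..j'} \<Longrightarrow> i' = i \<and> j' = j" for i j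
  proof -
    have "{i..j} \<in> segments n"
      using that unfolding segments_def by force
    moreover have "J = {i..j}" if "J \<in> segments n" "Q J" "{i..j} \<subseteq> J" for J
    proof -
      obtain i' j' where ij': "J = {i'..j'}" "1 \<le> i'" "i' \<le> j'" "j' \<le> n"
        using \<open>J \<in> segments n\<close> unfolding segments_def by blast
      then have "i' \<le> i" "j \<le> j'"
        using \<open>{i..j} \<subseteq> J\<close> \<open>i < j\<close> by auto
      then show ?thesis
        using max[of i' j'] ij' \<open>Q J\<close> by simp
    qed
    ultimately show ?thesis
      using that unfolding biruns_def maximal_segments_def Q_def by auto
  qed
  have "bij_betw Min (biruns n \<pi>) ?S"
    unfolding bij_betw_def
  proof
    show "inj_on Min (biruns n \<pi>)"
    proof (rule inj_onI)
      fix I J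
      assume I: "I \<in> biruns n \<pi>" and J: "J \<in> biruns n \<pi>" and eq: "Min I = Min J"
      obtain i j where ij: "I = {i..j}" "1 \<le> i" "i < j" "j \<le> n" "Q {i..j}"
        and maxI: "\<And>i' j'. 1 \<le> i' \<and> i' \<le> i \<and> j \<le> j' \<and> j' \<le> n \<and> Q {i'..j'} \<Longrightarrow> i' = i \<and> j' = j"
        using birunsD[OF I] by blast
      obtain k l where kl: "J = {k..l}" "1 \<le> k" "k < l" "l \<le> n" "Q {k..l}"
        and maxJ: "\<And>i' j'. 1 \<le> i' \<and> i' \<le> k \<and> l \<le> j' \<and> j' \<le> n \<and> Q {i'..j'} \<Longrightarrow> i' = k \<and> j' = l"
        using birunsD[OF J] by blast
      have "i = k"
        using eq ij kl by (simp add: Min_segment)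
      \<comment> \<open>Segments with a common left end are nested, so maximality of both makes them
        equal.\<close>
      moreover have "j = l"
        using maxI[of k l] maxJ[of i j] ij kl \<open>i = k\<close> by (metis le_refl nat_le_linear)
      ultimately show "I = J"
        using ij kl by simp
    qed
    show "Min ` biruns n \<pi> = ?S"
    proof (intro equalityI subsetI)
      fix m
      assume "m \<in> Min ` biruns n \<pi>"
      then obtain I where I: "I \<in> biruns n \<pi>" "m = Min I"
        by blast
      then obtain i j where ij: "I = {i..j}" "1 \<le> i" "i < j" "j \<le> n" "Q {i..j}"
        and max: "\<And>i' j'. 1 \<le> i' \<and> i' \<le> i \<and> j \<le> j' \<and> j' \<le> n \<and> Q {i'..j'} \<Longrightarrow> i' = i \<and> j' = j"
        using birunsD[OF I(1)] by blast
      have "m = i"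
        using I ij by (simp add: Min_segment)
      moreover have "(\<pi> (i - 1) < \<pi> i) \<noteq> (\<pi> i < \<pi> (Suc i))" if "i \<noteq> 1"
      proof
        \<comment> \<open>Otherwise the segment could be prolonged to the left by one
          position.\<close>
        assume same: "(\<pi> (i - 1) < \<pi> i) = (\<pi> i < \<pi> (Suc i))"
        have up: "\<pi> k < \<pi> (Suc k) \<longleftrightarrow> \<pi> i < \<pi> (Suc i)" if "i - 1 \<le> k" "k < j" for k
        proof (cases "k = i - 1")
          case True
          then show ?thesis
            using same \<open>1 \<le> i\<close> by simp
        next
          case False
          then have "i \<le> k"
            using that by simp
          then show ?thesis
            using ij that unfolding Q_iff by blast
        qed
        have "Q {i - 1..j}"
          unfolding Q_iff using up by blast
        moreover have "1 \<le> i - 1"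
          using ij(2) that by linarith
        ultimately show False
          using max[of "i - 1" j] ij by auto
      qed
      ultimately show "m \<in> ?S"
        using ij by auto
    next
      fix i
      assume i: "i \<in> ?S"
      define j where "j = Max {j \<in> {Suc i..n}. Q {i..j}}"
      \<comment> \<open>A single step is always monotone, so the set defining \<open>j\<close> is
        nonempty. The birun sought is the longest monotone segment starting at
        \<open>i\<close>.\<close>
      have "Suc i \<in> {j \<in> {Suc i..n}. Q {i..j}}"
        using i by (auto simp: Q_iff less_Suc_eq_le)
      then have j: "j \<in> {j \<in> {Suc i..n}. Q {i..j}}"
        unfolding j_def by (intro Max_in) auto
      have "{i..j} \<in> biruns n \<pi>"
      proof (rule birunsI)
        fix i' j'
        assume *: "1 \<le> i'" "i' \<le> i" "j \<le> j'" "j' \<le> n" "Q {i'..j'}"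
        have "i' = i"
        proof (rule ccontr)
          assume "i' \<noteq> i"
          then have "i' \<le> i - 1" "i - 1 < j'" "i' \<le> i" "i < j'" "i \<noteq> 1" "Suc (i - 1) = i"
            using * i j by auto
          then have "(\<pi> (i - 1) < \<pi> i) = (\<pi> i < \<pi> (Suc i))"
            using *(5) unfolding Q_iff by metis
          then show False
            using i \<open>i \<noteq> 1\<close> by simp
        qed
        moreover have "j' \<le> j"
          unfolding j_def using * j \<open>i' = i\<close> by (intro Max_ge) auto
        ultimately show "i' = i \<and> j' = j"
          using * by simp
      qed (use i j in auto)
      moreover have "Min {i..j} = i"
        using j by (auto simp: Min_segment)
      ultimately show "i \<in> Min ` biruns n \<pi>"
        by (metis imageI)
    qed
  qed
  then show ?thesis
    by (rule bij_betw_same_card)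
qed

text \<open>Any longer increasing segment starting at 1 contains \<open>{1..2}\<close>, so only the
  first step matters.\<close>

lemma singleton_in_increasing_runs_iff:
  assumes "1 \<le> n"
  shows "{1} \<in> increasing_runs n \<pi> \<longleftrightarrow> n = 1 \<or> \<not> \<pi> 1 < \<pi> 2"
proof
  assume run: "{1} \<in> increasing_runs n \<pi>"
  show "n = 1 \<or> \<not> \<pi> 1 < \<pi> 2"
  proof (rule ccontr)
    assume "\<not> ?thesis"
    then have "{1..2} \<in> segments n" "strict_mono_on {1..2} \<pi>"
      using assms unfolding segments_def strict_mono_on_segment_iff
      by (force simp: numeral_2_eq_2)+
    then have "{1..2::nat} = {1}"
      using run unfolding increasing_runs_def maximal_segments_def by fastforce
    then have "(2::nat) \<in> {1}"
      by (metis atLeastAtMost_iff one_le_numeral order_refl)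
    then show False
      by simp
  qed
next
  assume "n = 1 \<or> \<not> \<pi> 1 < \<pi> 2"
  then have "{i..j} = {1}" if "1 \<le> i" "i \<le> 1" "1 \<le> j" "j \<le> n" "strict_mono_on {i..j} \<pi>" for i j
    using that unfolding strict_mono_on_segment_iff by (cases "j = 1") (force simp: numeral_2_eq_2)+
  moreover have "{1} \<in> segments n"
    using assms unfolding segments_def by force
  ultimately show "{1} \<in> increasing_runs n \<pi>"
    unfolding increasing_runs_def maximal_segments_def segments_def
    by (auto simp: strict_mono_on_def)
qed

text \<open>Both sides are one more than the number of changes in the directions \<open>w\<close>,
  where \<open>w 1\<close> is a fictitious ascent. If \<pi> begins with an ascent, the extra unit is
  the birun starting at 1. If it begins with a descent, the change at 1 accounts for that birun and
  the extra unit is the letter \<open>{1}\<close>. For \<open>n = 1\<close> only this letter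
  remains.\<close>

lemma udr_eq_code_runs:
  assumes \<pi>: "\<pi> permutes {1..n}"
  shows "udr n \<pi> = code_runs (perm_code \<pi> n)"
proof (cases "n = 0")
  case True
  then show ?thesis
    by (auto simp: udr_def up_down_runs_def biruns_def increasing_runs_def maximal_segments_def
        segments_def)
next
  case False
  define w where "w j = ascent_last (perm_code \<pi> j)" for j
  have w0: "\<not> w 0" and w1: "w (Suc 0)"
    by (simp_all add: w_def)
  have w: "w (Suc i) \<longleftrightarrow> \<pi> i < \<pi> (Suc i)" if "1 \<le> i" "i < n" for i
    using ascent_last_perm_code[OF \<pi>, of "i - 1"] that by (simp add: w_def)
  let ?C = "{i. 1 \<le> i \<and> i < n \<and> w i \<noteq> w (Suc i)}"
  have "{j \<in> {1..n}. w j \<noteq> w (j - 1)} = insert 1 (Suc ` ?C)"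
  proof (intro equalityI subsetI)
    fix j
    assume j: "j \<in> {j \<in> {1..n}. w j \<noteq> w (j - 1)}"
    show "j \<in> insert 1 (Suc ` ?C)"
    proof (cases "j = 1")
      case False
      then have "j - 1 \<in> ?C" "j = Suc (j - 1)"
        using j by auto
      then show ?thesis
        by blast
    qed simp
  qed (use w0 w1 False in auto)
  moreover have "1 \<notin> Suc ` ?C"
    by auto
  moreover have "finite ?C"
    by simp
  ultimately have runs: "code_runs (perm_code \<pi> n) = Suc (card ?C)"
    unfolding code_runs_perm_code w_def[symmetric] by (simp add: card_image)
  have S: "{i. 1 \<le> i \<and> i < n \<and> (i = 1 \<or> (\<pi> (i - 1) < \<pi> i) \<noteq> (\<pi> i < \<pi> (Suc i)))} =
      (if n = 1 then {} else insert 1 ?C)"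
  proof -
    have "(i = 1 \<or> (\<pi> (i - 1) < \<pi> i) \<noteq> (\<pi> i < \<pi> (Suc i))) \<longleftrightarrow> i = 1 \<or> w i \<noteq> w (Suc i)"
      if "1 \<le> i" "i < n" for i
    proof (cases "i = 1")
      case False
      then have "w i \<longleftrightarrow> \<pi> (i - 1) < \<pi> i"
        using w[of "i - 1"] that by simp
      then show ?thesis
        using w[OF that] by simp
    qed simp
    then show ?thesis
      using False by auto
  qed
  have "biruns n \<pi> \<subseteq> Pow {1..n}"
    by (auto simp: biruns_def maximal_segments_def segments_def)
  then have fin: "finite (biruns n \<pi>)"
    by (rule finite_subset) simp
  have "{1} \<notin> biruns n \<pi>"
    by (simp add: biruns_def)
  moreover have "{I \<in> increasing_runs n \<pi>. I = {1}} = (if {1} \<in> increasing_runs n \<pi> then {{1}} else {})"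
    by auto
  ultimately have "udr n \<pi> = card (biruns n \<pi>) + (if {1} \<in> increasing_runs n \<pi> then 1 else 0)"
    using fin unfolding udr_def up_down_runs_def by simp
  also have "\<dots> = Suc (card ?C)"
  proof (cases "n = 1")
    case True
    then have "?C = {}"
      by auto
    then show ?thesis
      using singleton_in_increasing_runs_iff[of n \<pi>] True unfolding card_biruns[OF \<pi>] S by simp
  next
    case n: False
    then have "w 2 \<longleftrightarrow> \<pi> 1 < \<pi> 2"
      using w[of 1] False by (simp add: numeral_2_eq_2)
    then have "1 \<in> ?C \<longleftrightarrow> \<not> \<pi> 1 < \<pi> 2"
      using w1 n False by (simp add: numeral_2_eq_2)
    then show ?thesis
      using singleton_in_increasing_runs_iff[of n \<pi>] n False
      unfolding card_biruns[OF \<pi>] S by (auto simp: card_insert_if)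
  qed
  finally show ?thesis
    using runs by simp
qed

section \<open>Splitting off increasing tails\<close>

definition code_sum :: "'a::comm_ring_1 \<Rightarrow> nat \<Rightarrow> (nat list \<Rightarrow> 'a) \<Rightarrow> 'a" where
  "code_sum q n c = (\<Sum>a \<in> codes n. q ^ sum_list a * c a)"

lemma code_sum_cong:
  "(\<And>a. length a = n \<Longrightarrow> c a = c' a) \<Longrightarrow> code_sum q n c = code_sum q n c'"
  unfolding code_sum_def by (intro sum.cong refl) (simp add: length_codes)

lemma code_sum_mult_left: "code_sum q n (\<lambda>a. r * c a) = r * code_sum q n c"
  by (simp add: code_sum_def sum_distrib_left mult.left_commute)

lemma code_sum_add: "code_sum q n (\<lambda>a. c a + c' a) = code_sum q n c + code_sum q n c'"
  by (simp add: code_sum_def distrib_left sum.distrib)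

lemma code_sum_sum: "code_sum q n (\<lambda>a. \<Sum>k \<in> K. c k a) = (\<Sum>k \<in> K. code_sum q n (c k))"
  unfolding code_sum_def sum_distrib_left by (rule sum.swap)

lemma code_sum_0 [simp]: "code_sum q 0 c = c []"
  by (simp add: code_sum_def)

lemma P_inv_udr_eq_code_sum: "P_inv_udr n q t = code_sum q n (\<lambda>a. t ^ code_runs a)"
  unfolding P_inv_udr_def code_sum_def
  by (subst sum.reindex_bij_betw[OF bij_betw_perm_code, symmetric])
     (auto intro!: sum.cong simp: udr_eq_code_runs sum_list_perm_code)

section \<open>Partitions in a box and Gaussian binomial coefficients\<close>

definition boxes :: "nat \<Rightarrow> nat \<Rightarrow> nat list set" where
  "boxes k m = {b. length b = m \<and> sorted b \<and> set b \<subseteq> {..k}}"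

text \<open>The members of \<open>boxes k m\<close> are partitions with at most \<open>m\<close>
  parts, each at most \<open>k\<close>, padded by zeros. The sum is the Gaussian binomial
  coefficient of \<open>k + m\<close> over \<open>m\<close>.\<close>

definition box_sum :: "'a::comm_ring_1 \<Rightarrow> nat \<Rightarrow> nat \<Rightarrow> 'a" where
  "box_sum q k m = (\<Sum>b \<in> boxes k m. q ^ sum_list b)"

lemma finite_boxes [simp]: "finite (boxes k m)"
  by (rule finite_subset[OF _ finite_lists_length_eq[of "{..k}" m]]) (auto simp: boxes_def)

lemma boxes_0_right: "boxes k 0 = {[]}"
  by (auto simp: boxes_def)

lemma boxes_0_left: "boxes 0 m = {replicate m 0}"
proof (intro equalityI subsetI)
  fix b
  assume "b \<in> boxes 0 m"
  then show "b \<in> {replicate m 0}"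
    by (auto simp: boxes_def intro!: replicate_eqI)
qed (auto simp: boxes_def)

text \<open>The last entry is the largest part; either it attains the bound \<open>Suc k\<close> and
  is removed, or all parts are at most \<open>k\<close>.\<close>

lemma boxes_Suc_Suc:
  "boxes (Suc k) (Suc m) = boxes k (Suc m) \<union> (\<lambda>b. b @ [Suc k]) ` boxes (Suc k) m"
proof (intro equalityI subsetI)
  fix b
  assume b: "b \<in> boxes (Suc k) (Suc m)"
  then obtain b' y where b': "b = b' @ [y]"
    by (cases b rule: rev_cases) (auto simp: boxes_def)
  show "b \<in> boxes k (Suc m) \<union> (\<lambda>b. b @ [Suc k]) ` boxes (Suc k) m"
  proof (cases "y = Suc k")
    case True
    then show ?thesis
      using b b' by (auto simp: boxes_def sorted_append)
  next
    case False
    then have "b \<in> boxes k (Suc m)"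
      using b b' by (fastforce simp: boxes_def sorted_append)
    then show ?thesis ..
  qed
qed (auto simp: boxes_def sorted_append)

lemma box_sum_0_right: "box_sum q k 0 = 1"
  by (simp add: box_sum_def boxes_0_right)

lemma box_sum_0_left: "box_sum q 0 m = 1"
  by (simp add: box_sum_def boxes_0_left sum_list_replicate)

text \<open>The q-Pascal rule.\<close>

lemma box_sum_Suc_Suc:
  "box_sum q (Suc k) (Suc m) = box_sum q k (Suc m) + q ^ Suc k * box_sum q (Suc k) m"
proof -
  have "boxes k (Suc m) \<inter> (\<lambda>b. b @ [Suc k]) ` boxes (Suc k) m = {}"
    by (auto simp: boxes_def)
  then have "box_sum q (Suc k) (Suc m) = box_sum q k (Suc m) +
      (\<Sum>b \<in> (\<lambda>b. b @ [Suc k]) ` boxes (Suc k) m. q ^ sum_list b)"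
    unfolding box_sum_def boxes_Suc_Suc by (intro sum.union_disjoint) auto
  also have "(\<Sum>b \<in> (\<lambda>b. b @ [Suc k]) ` boxes (Suc k) m. q ^ sum_list b) =
      q ^ Suc k * box_sum q (Suc k) m"
    by (subst sum.reindex)
       (auto simp: inj_on_def box_sum_def sum_distrib_left power_add mult_ac)
  finally show ?thesis .
qed

lemma q_fact_0 [simp]: "q_fact q 0 = 1"
  by (simp add: q_fact_def)

lemma q_fact_Suc: "q_fact q (Suc n) = (\<Sum>i<Suc n. q ^ i) * q_fact q n"
  by (simp add: q_fact_def prod.nat_ivl_Suc' mult.commute)

lemma q_int_add: "(\<Sum>i<k + m. q ^ i) = (\<Sum>i<k. q ^ i) + q ^ k * (\<Sum>i<m. (q::'a::comm_ring_1) ^ i)"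
  by (induction m) (simp_all add: algebra_simps power_add)

text \<open>The product formula for Gaussian binomials in division-free form. The double induction
  combines the q-Pascal rule with [k + m] = [k] + q^k [m].\<close>

lemma box_sum_q_fact:
  fixes q :: "'a::comm_ring_1"
  shows "box_sum q k m * q_fact q k * q_fact q m = q_fact q (k + m)"
proof (induction k arbitrary: m)
  case (Suc k)
  note IH_k = Suc.IH
  show ?case
  proof (induction m)
    case (Suc m)
    let ?i = "\<lambda>n. \<Sum>i<n. q ^ i"
    have "box_sum q (Suc k) (Suc m) * q_fact q (Suc k) * q_fact q (Suc m) =
        ?i (Suc k) * (box_sum q k (Suc m) * q_fact q k * q_fact q (Suc m)) +
        q ^ Suc k * ?i (Suc m) * (box_sum q (Suc k) m * q_fact q (Suc k) * q_fact q m)"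
      unfolding box_sum_Suc_Suc q_fact_Suc by (simp only: algebra_simps)
    also have "\<dots> = (?i (Suc k) + q ^ Suc k * ?i (Suc m)) * q_fact q (Suc (k + m))"
      unfolding IH_k Suc.IH by (simp add: algebra_simps del: sum.lessThan_Suc)
    also have "\<dots> = q_fact q (Suc k + Suc m)"
      unfolding q_int_add[symmetric] by (simp add: q_fact_Suc del: sum.lessThan_Suc)
    finally show ?case .
  qed (simp add: box_sum_0_right)
qed (simp add: box_sum_0_left)

text \<open>In a sorted block \<open>b\<close> the oldest letter comes last and has the largest
  entry. Its bound as a code entry is \<open>k\<close>, so all of \<open>b\<close> is bounded by
  \<open>k\<close>, which implies the weaker bounds on the newer letters.\<close>

lemma codes_append_iff:
  "b @ a \<in> codes (k + m) \<and> sorted b \<longleftrightarrow> b \<in> boxes k m \<and> a \<in> codes k"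
  if "length b = m" "length a = k"
  using that
proof (induction b arbitrary: m)
  case (Cons x b)
  then obtain m' where m: "m = Suc m'" "length b = m'"
    by auto
  have "x \<le> k" if "set b \<subseteq> {..k}" "b = [] \<longrightarrow> x \<le> k" "\<forall>y \<in> set b. x \<le> y"
    using that by (cases b) auto
  with Cons.IH[OF m(2) Cons.prems(2)] m show ?case
    by (cases b) (auto simp: boxes_def Cons_in_codes simp del: codes.simps)
qed (auto simp: boxes_def length_codes)

lemma codes_sorted_take:
  "{a \<in> codes (k + m). sorted (take m a)} = (\<lambda>(b, a). b @ a) ` (boxes k m \<times> codes k)"
proof (intro equalityI subsetI)
  fix a
  assume a: "a \<in> {a \<in> codes (k + m). sorted (take m a)}"
  then have "length (take m a) = m" "length (drop m a) = k"
    using length_codes by fastforce+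
  then have "(take m a, drop m a) \<in> boxes k m \<times> codes k"
    using codes_append_iff[of "take m a" m "drop m a" k] a by simp
  then show "a \<in> (\<lambda>(b, a). b @ a) ` (boxes k m \<times> codes k)"
    by (metis (no_types, lifting) append_take_drop_id case_prod_conv image_eqI)
next
  fix a
  assume "a \<in> (\<lambda>(b, a). b @ a) ` (boxes k m \<times> codes k)"
  then obtain b a' where "a = b @ a'" "b \<in> boxes k m" "a' \<in> codes k"
    by auto
  moreover have "length b = m" "length a' = k"
    using calculation length_codes by (auto simp: boxes_def)
  ultimately show "a \<in> {a \<in> codes (k + m). sorted (take m a)}"
    using codes_append_iff[of b m a' k] by simp
qed

text \<open>The weight of \<open>b @ a\<close> is a product and \<open>c\<close> sees only
  \<open>a\<close>, so the sum over pairs factorizes.\<close>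

lemma code_sum_sorted_take:
  "code_sum q (k + m) (\<lambda>a. if sorted (take m a) then c (drop m a) else 0) =
     box_sum q k m * code_sum q k c"
proof -
  let ?f = "\<lambda>a. q ^ sum_list a * c (drop m a)"
  have "code_sum q (k + m) (\<lambda>a. if sorted (take m a) then c (drop m a) else 0) =
      (\<Sum>a \<in> {a \<in> codes (k + m). sorted (take m a)}. ?f a)"
    unfolding code_sum_def by (rule sum.mono_neutral_cong_right) auto
  also have "\<dots> = (\<Sum>(b, a) \<in> boxes k m \<times> codes k. ?f (b @ a))"
    unfolding codes_sorted_take
    by (subst sum.reindex) (auto simp: inj_on_def boxes_def case_prod_unfold)
  also have "\<dots> = (\<Sum>b \<in> boxes k m. \<Sum>a \<in> codes k. q ^ sum_list b * (q ^ sum_list a * c a))"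
    unfolding sum.cartesian_product[symmetric]
    by (intro sum.cong refl) (auto simp: boxes_def power_add mult_ac)
  also have "\<dots> = box_sum q k m * code_sum q k c"
    by (simp add: box_sum_def code_sum_def sum_product)
  finally show ?thesis .
qed

text \<open>
  The sum over all ways to split off an increasing tail of \<open>m\<close> letters, weighted by \<open>s ^ m\<close>.
  On generating functions this is multiplication by \<open>exp_q q\<close> at \<open>s * x\<close>.
\<close>

definition inc_tail :: "'a::comm_ring_1 \<Rightarrow> (nat list \<Rightarrow> 'a) \<Rightarrow> nat list \<Rightarrow> 'a" where
  "inc_tail s c a =
     (\<Sum>m \<le> length a. if sorted (take m a) then s ^ m * c (drop m a) else 0)"

lemma inc_tail_Nil [simp]: "inc_tail s c [] = c []"
  by (simp add: inc_tail_def)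

text \<open>The first summand is the empty tail. A nonempty tail contains \<open>x\<close>: after an
  ascent it extends an arbitrary increasing tail of \<open>a\<close>, after a descent it is
  \<open>x\<close> alone.\<close>

lemma inc_tail_Cons:
  "inc_tail s c (x # a) =
     c (x # a) + s * (if ascent_last (x # a) then inc_tail s c a else c a)"
proof -
  have *: "inc_tail s c (x # a) = c (x # a) +
      (\<Sum>m \<le> length a. if sorted (x # take m a) then s ^ Suc m * c (drop m a) else 0)"
    unfolding inc_tail_def by (simp only: list.size add_Suc_right add_0_right sum.atMost_Suc_shift take_Suc_Cons drop_Suc_Cons) simp
  show ?thesis
  proof (cases "ascent_last (x # a)")
    case True
    then have "sorted (x # take m a) \<longleftrightarrow> sorted (take m a)" for m
      by (cases a; cases m) auto
    then show ?thesis
      unfolding * using True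
      by (simp add: inc_tail_def sum_distrib_left if_distrib mult.assoc cong: if_cong)
  next
    case False
    then have "sorted (x # take m a) \<longleftrightarrow> m = 0" for m
      by (cases a; cases m) auto
    then show ?thesis
      unfolding * using False by (simp add: sum.delta cong: if_cong)
  qed
qed

lemma code_sum_inc_tail:
  "code_sum q n (inc_tail s c) =
     (\<Sum>k \<le> n. s ^ (n - k) * box_sum q k (n - k) * code_sum q k c)"
proof -
  have "code_sum q n (inc_tail s c) = code_sum q n
      (\<lambda>a. \<Sum>m \<le> n. s ^ m * (if sorted (take m a) then c (drop m a) else 0))"
    by (rule code_sum_cong) (auto simp: inc_tail_def intro!: sum.cong)
  also have "\<dots> = (\<Sum>m \<le> n. s ^ m *
      code_sum q n (\<lambda>a. if sorted (take m a) then c (drop m a) else 0))"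
    by (simp add: code_sum_sum code_sum_mult_left)
  also have "\<dots> = (\<Sum>m \<le> n. s ^ m * (box_sum q (n - m) m * code_sum q (n - m) c))"
  proof (intro sum.cong refl)
    fix m
    assume "m \<in> {..n}"
    then show "s ^ m * code_sum q n (\<lambda>a. if sorted (take m a) then c (drop m a) else 0) =
        s ^ m * (box_sum q (n - m) m * code_sum q (n - m) c)"
      using code_sum_sorted_take[of q "n - m" m c] by simp
  qed
  also have "\<dots> = (\<Sum>k \<le> n. s ^ (n - k) * box_sum q k (n - k) * code_sum q k c)"
    by (rule sum.reindex_bij_witness[of _ "\<lambda>k. n - k" "\<lambda>k. n - k"]) (auto simp: mult.assoc)
  finally show ?thesis .
qed

section \<open>Generating functions\<close>

text \<open>The axioms of \<open>idom_divide\<close> determine only exact quotients. For a unit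
  \<open>y\<close> every quotient is exact, and \<open>1 / y\<close> is the inverse. This covers
  fields and power series rings alike.\<close>

lemma divide_unit:
  fixes x y :: "'a::{idom_divide,inverse}"
  assumes "y dvd 1"
  shows "x / y = x * (1 / y)" and "1 / y * y = 1"
proof -
  from assms obtain z where z: "y * z = 1"
    by (metis dvdE)
  then have y: "y \<noteq> 0"
    by auto
  have *: "w / y = w * z" for w
  proof -
    have "w * z * y = w"
      using z by algebra
    then show ?thesis
      using nonzero_mult_div_cancel_right[OF y, of "w * z"] by (simp only:)
  qed
  show "x / y = x * (1 / y)" "1 / y * y = 1"
    using z by (simp_all add: * mult.commute)
qed

definition code_egf :: "'a::{idom_divide,inverse} \<Rightarrow> (nat list \<Rightarrow> 'a) \<Rightarrow> 'a fps" where
  "code_egf q c = Abs_fps (\<lambda>n. code_sum q n c / q_fact q n)"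

text \<open>Dividing the Gaussian binomial by [n]! leaves 1 / ([k]! [n - k]!), which turns the sum
  over tail lengths into a Cauchy product.\<close>

lemma code_egf_inc_tail:
  assumes unit: "\<And>n. q_fact q n dvd 1"
  shows "code_egf q (inc_tail s c) = code_egf q c * Abs_fps (\<lambda>n. s ^ n / q_fact q n)"
proof (rule fps_ext)
  fix n
  note [simp] = divide_unit(1)[OF unit, of "code_sum q n c" for n c]
    divide_unit(1)[OF unit, of "s ^ n" for n]
  have *: "box_sum q k (n - k) * (1 / q_fact q n) = 1 / q_fact q k * (1 / q_fact q (n - k))"
    if "k \<le> n" for k
  proof -
    have "box_sum q k (n - k) * (1 / q_fact q n) = box_sum q k (n - k) * (1 / q_fact q n) *
        (1 / q_fact q k * q_fact q k) * (1 / q_fact q (n - k) * q_fact q (n - k))"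
      by (simp only: divide_unit(2)[OF unit] mult_1_right)
    also have "\<dots> = (box_sum q k (n - k) * q_fact q k * q_fact q (n - k)) * (1 / q_fact q n) *
        (1 / q_fact q k * (1 / q_fact q (n - k)))"
      by (simp only: mult_ac)
    also have "\<dots> = (1 / q_fact q n * q_fact q n) * (1 / q_fact q k * (1 / q_fact q (n - k)))"
      using box_sum_q_fact[of q k "n - k"] that by (simp only: le_add_diff_inverse mult_ac)
    finally show ?thesis
      by (simp only: divide_unit(2)[OF unit] mult_1_left)
  qed
  have "fps_nth (code_egf q (inc_tail s c)) n =
      (\<Sum>k \<le> n. s ^ (n - k) * code_sum q k c * (box_sum q k (n - k) * (1 / q_fact q n)))"
    unfolding code_egf_def fps_nth_Abs_fps code_sum_inc_tail
    by (subst divide_unit(1)[OF unit]) (simp add: sum_distrib_left mult_ac)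
  also have "\<dots> = fps_nth (code_egf q c * Abs_fps (\<lambda>n. s ^ n / q_fact q n)) n"
    unfolding fps_mult_nth atLeast0AtMost
    by (intro sum.cong refl) (simp add: *, simp add: code_egf_def mult_ac)
  finally show "fps_nth (code_egf q (inc_tail s c)) n = \<dots>" .
qed

text \<open>The \<open>q\<close>-derivative of the product vanishes by the \<open>q\<close>-Leibniz rule.\<close>

lemma exp_q_minus_times_Exp_q:
  fixes q :: "'a::{idom_divide,inverse}"
  assumes unit: "\<And>n. q_fact q n dvd 1"
  shows "Abs_fps (\<lambda>n. (-1) ^ n / q_fact q n) * Exp_q q = 1"
proof (rule fps_ext)
  fix n
  define i where "i n = (\<Sum>j<n. q ^ j)" for n
  define f where "f n = q ^ (n choose 2) / q_fact q n" for n
  define g where "g n = (-1) ^ n / q_fact q n" for n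
  have shift: "i (Suc n) * (1 / q_fact q (Suc n)) = 1 / q_fact q n" for n
  proof -
    have "i (Suc n) * (1 / q_fact q (Suc n)) =
        i (Suc n) * (1 / q_fact q (Suc n)) * (1 / q_fact q n * q_fact q n)"
      by (simp only: divide_unit(2)[OF unit] mult_1_right)
    also have "\<dots> = (1 / q_fact q (Suc n) * q_fact q (Suc n)) * (1 / q_fact q n)"
      unfolding q_fact_Suc i_def by (simp only: mult_ac)
    finally show ?thesis
      by (simp only: divide_unit(2)[OF unit] mult_1_left)
  qed
  have f_Suc: "i (Suc n) * f (Suc n) = q ^ n * f n" for n
    unfolding f_def divide_unit(1)[OF unit, of "q ^ (_ choose 2)"] mult.left_commute[of "i (Suc n)"] shift
    by (simp add: numeral_2_eq_2 power_add mult_ac)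
  have g_Suc: "i (Suc n) * g (Suc n) = - g n" for n
    unfolding g_def divide_unit(1)[OF unit, of "(-1) ^ _"] mult.left_commute[of "i (Suc n)"] shift
    by simp
  show "fps_nth (Abs_fps (\<lambda>n. (-1) ^ n / q_fact q n) * Exp_q q) n = fps_nth 1 n"
  proof (cases n)
    case 0
    then show ?thesis
      by (simp add: Exp_q_def binomial_eq_0)
  next
    case (Suc m)
    let ?w = "\<Sum>k \<le> Suc m. f k * g (Suc m - k)"
    \<comment> \<open>The Leibniz rule: [Suc m] is split as [k] + q^k [Suc m - k]. By
      \<open>f_Suc\<close> and \<open>g_Suc\<close> the two resulting sums are negatives of each
      other.\<close>
    have "i (Suc m) * ?w = (\<Sum>k \<le> Suc m. i k * f k * g (Suc m - k)) +
        (\<Sum>k \<le> Suc m. q ^ k * f k * (i (Suc m - k) * g (Suc m - k)))"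
      unfolding sum_distrib_left sum.distrib[symmetric]
    proof (intro sum.cong refl)
      fix k
      assume "k \<in> {..Suc m}"
      then have "i (Suc m) = i k + q ^ k * i (Suc m - k)"
        using q_int_add[of q k "Suc m - k"] by (simp add: i_def)
      then show "i (Suc m) * (f k * g (Suc m - k)) =
          i k * f k * g (Suc m - k) + q ^ k * f k * (i (Suc m - k) * g (Suc m - k))"
        by (simp only: algebra_simps)
    qed
    also have "(\<Sum>k \<le> Suc m. i k * f k * g (Suc m - k)) = (\<Sum>k \<le> m. q ^ k * f k * g (m - k))"
      by (simp only: sum.atMost_Suc_shift f_Suc) (simp add: i_def)
    also have "(\<Sum>k \<le> Suc m. q ^ k * f k * (i (Suc m - k) * g (Suc m - k))) =
        (\<Sum>k \<le> m. q ^ k * f k * (i (Suc m - k) * g (Suc m - k)))"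
      by (simp add: i_def)
    also have "\<dots> = (\<Sum>k \<le> m. - (q ^ k * f k * g (m - k)))"
      by (intro sum.cong refl) (simp add: Suc_diff_le g_Suc)
    finally have "i (Suc m) * ?w = 0"
      by (simp add: sum_negf)
    \<comment> \<open>This q-integer is a factor of a unit, so it can be cancelled.\<close>
    moreover have "i (Suc m) \<noteq> 0"
      using divide_unit(2)[OF unit, of "Suc m"] by (auto simp: q_fact_Suc i_def)
    ultimately have "?w = 0"
      by simp
    moreover have "fps_nth (Exp_q q * Abs_fps (\<lambda>n. (-1) ^ n / q_fact q n)) n = ?w"
      unfolding fps_mult_nth Suc atLeast0AtMost by (simp add: Exp_q_def f_def g_def)
    ultimately show ?thesis
      using Suc by (simp add: mult.commute)
  qed
qed

section \<open>Multiplicative weights and the functional equation\<close>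

primrec run_weight :: "'a::comm_ring_1 \<Rightarrow> 'a \<Rightarrow> nat list \<Rightarrow> 'a" where
  "run_weight u d [] = 1"
| "run_weight u d (x # a) =
     (if ascent_last (x # a) = ascent_last a then u else d) * run_weight u d a"

lemma run_weight_altdef: "run_weight u d a = u ^ (length a - code_runs a) * d ^ code_runs a"
proof (induction a)
  case (Cons x a)
  then show ?case
    using Suc_diff_le[OF code_runs_le[of a]]
    by (cases "ascent_last (x # a) = ascent_last a") (simp_all del: ascent_last.simps)
qed simp

lemma code_egf_add:
  assumes "\<And>n. q_fact q n dvd 1"
  shows "code_egf q (\<lambda>a. c a + c' a) = code_egf q c + code_egf q c'"
proof (rule fps_ext)
  fix n
  show "fps_nth (code_egf q (\<lambda>a. c a + c' a)) n = fps_nth (code_egf q c + code_egf q c') n"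
    using divide_unit(1)[OF assms[of n], of "code_sum q n c + code_sum q n c'"]
      divide_unit(1)[OF assms[of n], of "code_sum q n c"]
      divide_unit(1)[OF assms[of n], of "code_sum q n c'"]
    by (simp add: code_egf_def code_sum_add distrib_right)
qed

lemma code_egf_mult_left:
  assumes "\<And>n. q_fact q n dvd 1"
  shows "code_egf q (\<lambda>a. r * c a) = fps_const r * code_egf q c"
proof (rule fps_ext)
  fix n
  show "fps_nth (code_egf q (\<lambda>a. r * c a)) n = fps_nth (fps_const r * code_egf q c) n"
    using divide_unit(1)[OF assms[of n], of "r * code_sum q n c"]
      divide_unit(1)[OF assms[of n], of "code_sum q n c"]
    by (simp add: code_egf_def code_sum_mult_left mult.assoc)
qed

lemma code_egf_Nil: "code_egf q (\<lambda>a. if a = [] then r else 0) = fps_const r"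
proof (rule fps_ext)
  fix n
  have "code_sum q n (\<lambda>a. if a = [] then r else 0) = (if n = 0 then r else 0)"
    by (cases "n = 0") (auto simp: code_sum_def intro!: sum.neutral dest: length_codes)
  then show "fps_nth (code_egf q (\<lambda>a. if a = [] then r else 0)) n = fps_nth (fps_const r) n"
    by (simp add: code_egf_def)
qed

lemma code_egf_run_weight:
  fixes q t u d :: "'a::{idom_divide,inverse}"
  assumes unit: "\<And>n. q_fact q n dvd 1" and u: "u = 1 + t * d" and d: "d = t * (1 + u)"
  shows "(fps_const (1 - t) + fps_const (1 + t) * code_egf q (run_weight u d)) *
      (1 - fps_const (t ^ 2) * exp_q q * Exp_q q) =
    2 * (fps_const (1 - t) * (1 + fps_const t * exp_q q))"
proof -
  \<comment> \<open>If the last letter lies in an odd or even segment with weights in ratio 1 : t,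
    allowing empty segments after it changes the ratio to 1 + t^2 : 2 t, that is \<open>u\<close> :
    \<open>d\<close>. The ratio t : 1 is symmetric.\<close>
  define e where "e a = (if ascent_last a then d else u) * run_weight u d a" for a
  define od where "od a = (if ascent_last a then u else d) * run_weight u d a" for a
  \<comment> \<open>The correction for the cut of the empty word into zero segments. Twice the even
    count is \<open>e + ind\<close>; removing that cut, which is counted twice, leaves
    \<open>e - ind\<close>.\<close>
  define ind where "ind a = (if a = [] then 1 else 0 :: 'a)" for a :: "nat list"
  \<comment> \<open>A cut into an odd number of segments is an even one followed by an increasing
    segment.\<close>
  have o_tail: "od a = t * inc_tail 1 (\<lambda>a. e a + ind a) a" for a
  proof (induction a)
    case Nil
    show ?case
      using d by (simp add: od_def e_def ind_def add.commute)
  next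
    case (Cons x a)
    define w where "w = run_weight u d (x # a)"
    have "t * inc_tail 1 (\<lambda>a. e a + ind a) (x # a) =
        t * e (x # a) + (if ascent_last (x # a) then od a else t * e a)"
      using Cons.IH by (cases "a = []") (auto simp: inc_tail_Cons ind_def algebra_simps)
    \<comment> \<open>The weight \<open>w\<close> equals \<open>od a\<close> after an ascent and
      \<open>e a\<close> after a descent.\<close>
    also have "\<dots> = (if ascent_last (x # a) then t * d * w + w else t * u * w + t * w)"
      by (cases "ascent_last (x # a)") (auto simp: e_def od_def w_def simp del: ascent_last.simps)
    also have "\<dots> = od (x # a)"
    proof (cases "ascent_last (x # a)")
      case True
      have "t * d * w + w = u * w"
        using u by algebra
      then show ?thesis
        using True by (simp add: od_def w_def)
    next
      case False
      have "t * u * w + t * w = d * w"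
        using d by algebra
      then show ?thesis
        using False by (simp add: od_def w_def)
    qed
    finally show ?case ..
  qed
  \<comment> \<open>Appending a decreasing segment multiplies by \<open>Exp_q q\<close>. Moving this
    factor to the other side as its inverse gives increasing tails with sign
    \<open>-1\<close>.\<close>
  have e_tail: "inc_tail (-1) (\<lambda>a. e a + (-1) * ind a) a = t * od a" for a
  proof (induction a)
    case Nil
    show ?case
      using u by (simp add: od_def e_def ind_def)
  next
    case (Cons x a)
    define w where "w = run_weight u d (x # a)"
    have "inc_tail (-1) (\<lambda>a. e a + (-1) * ind a) (x # a) =
        e (x # a) - (if ascent_last (x # a) then t * od a else e a)"
      using Cons.IH by (cases "a = []") (auto simp: inc_tail_Cons ind_def algebra_simps)
    also have "\<dots> = (if ascent_last (x # a) then d * w - t * w else u * w - w)"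
      by (cases "ascent_last (x # a)") (auto simp: e_def od_def w_def simp del: ascent_last.simps)
    also have "\<dots> = t * od (x # a)"
    proof (cases "ascent_last (x # a)")
      case True
      have "d * w - t * w = t * (u * w)"
        using d by algebra
      then show ?thesis
        using True by (simp add: od_def w_def)
    next
      case False
      have "u * w - w = t * (d * w)"
        using u by algebra
      then show ?thesis
        using False by (simp add: od_def w_def)
    qed
    finally show ?case .
  qed
  let ?E = "exp_q q" and ?E' = "Abs_fps (\<lambda>n. (-1) ^ n / q_fact q n)" and ?F = "Exp_q q"
  let ?e = "code_egf q e" and ?o = "code_egf q od" and ?t = "fps_const t"
  have ind: "code_egf q ind = 1"
    unfolding ind_def code_egf_Nil by simp
  have "?o = code_egf q (\<lambda>a. t * inc_tail 1 (\<lambda>a. e a + ind a) a)"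
    by (simp only: o_tail[symmetric])
  also have "\<dots> = ?t * ((?e + 1) * Abs_fps (\<lambda>n. 1 ^ n / q_fact q n))"
    by (simp only: code_egf_mult_left[OF unit] code_egf_inc_tail[OF unit] code_egf_add[OF unit] ind)
  finally have 1: "?o = ?t * ((?e + 1) * ?E)"
    by (simp add: exp_q_def)
  have "?t * ?o = code_egf q (\<lambda>a. inc_tail (-1) (\<lambda>a. e a + (-1) * ind a) a)"
    by (simp only: e_tail code_egf_mult_left[OF unit])
  also have "\<dots> = (?e + fps_const (-1) * 1) * ?E'"
    by (simp only: code_egf_mult_left[OF unit] code_egf_inc_tail[OF unit] code_egf_add[OF unit] ind)
  also have "fps_const (-1) = (-1 :: 'a fps)"
    by (metis fps_const_1_eq_1 fps_const_neg)
  finally have "?t * ?o * ?F = (?e - 1) * (?E' * ?F)"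
    by (simp add: mult.assoc)
  then have 2: "?e - 1 = ?t * ?o * ?F"
    by (simp only: exp_q_minus_times_Exp_q[OF unit] mult_1_right)
  \<comment> \<open>Summing over both parities removes the dependence on the last direction.\<close>
  have "e a + od a = (u + d) * run_weight u d a" for a
    by (simp add: e_def od_def algebra_simps)
  then have "?e + ?o = fps_const (u + d) * code_egf q (run_weight u d)"
    by (simp only: code_egf_add[OF unit, symmetric] code_egf_mult_left[OF unit, symmetric])
  moreover have "(1 - t) * (u + d) = 1 + t"
    using u d by algebra
  ultimately have 3: "fps_const (1 - t) * (?e + ?o) =
      fps_const (1 + t) * code_egf q (run_weight u d)"
    by (simp add: mult.assoc[symmetric])
  \<comment> \<open>Substituting the odd equation into the even one eliminates
    \<open>?o\<close>.\<close>
  have "(?e + 1) * (1 - ?t * ?t * ?E * ?F) = 2"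
    using 1 2 by algebra
  moreover have "1 + (?e + ?o) = (?e + 1) * (1 + ?t * ?E)"
    using 1 by algebra
  moreover have "y * D = 2 * z" if "x * D = 2" "y = x * z" for x y z D :: "'a fps"
  proof -
    have "y * D = x * D * z"
      by (simp only: that(2) mult_ac)
    then show ?thesis
      by (simp only: that(1))
  qed
  ultimately have 4: "(1 + (?e + ?o)) * (1 - ?t * ?t * ?E * ?F) = 2 * (1 + ?t * ?E)"
    by blast
  have "(fps_const (1 - t) + fps_const (1 - t) * (?e + ?o)) * (1 - ?t * ?t * ?E * ?F) =
      2 * (fps_const (1 - t) * (1 + ?t * ?E))"
    using 4 by algebra
  then show ?thesis
    unfolding 3 by (simp add: power2_eq_square)
qed

text \<open>Every letter contributes \<open>u\<close>, and each start of a run an additional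
  \<open>t\<close>.\<close>

lemma code_sum_run_weight:
  "code_sum q n (run_weight u (u * t)) = u ^ n * P_inv_udr n q t"
proof -
  have "code_sum q n (run_weight u (u * t)) = code_sum q n (\<lambda>a. u ^ n * t ^ code_runs a)"
  proof (rule code_sum_cong)
    fix a :: "nat list"
    assume "length a = n"
    then show "run_weight u (u * t) a = u ^ n * t ^ code_runs a"
      using code_runs_le[of a]
      by (simp add: run_weight_altdef power_mult_distrib mult.assoc[symmetric] power_add[symmetric])
  qed
  then show ?thesis
    by (simp add: code_sum_mult_left P_inv_udr_eq_code_sum)
qed

text \<open>With \<open>v\<close> as the parameter of the cuts, u = (1 + v^2) / (1 - v^2) and t = 2
  v / (1 + v^2) meet the two relations for d = u t. The hypotheses avoid division so as to fit both
  rings.\<close>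

lemma run_weight_relations:
  fixes u v t :: "'a::idom"
  assumes "1 - v ^ 2 \<noteq> 0" "u * (1 - v ^ 2) = 1 + v ^ 2" "t * (1 + v ^ 2) = 2 * v"
  shows "u = 1 + v * (u * t)" and "u * t = v * (1 + u)"
proof -
  have "(1 - v ^ 2) * u = (1 - v ^ 2) * (1 + v * (u * t))"
    using assms(2,3) by algebra
  then show "u = 1 + v * (u * t)"
    using assms(1) by simp
  have "(1 - v ^ 2) * (u * t) = (1 - v ^ 2) * (v * (1 + u))"
    using assms(2,3) by algebra
  then show "u * t = v * (1 + u)"
    using assms(1) by simp
qed

lemma P_inv_udr_0 [simp]: "P_inv_udr 0 q (t::'a::comm_ring_1) = 1"
  by (simp add: P_inv_udr_eq_code_sum)

section \<open>The coefficient rings\<close>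

lemma Fract_1_sum_power: "(\<Sum>i<k. Fract p 1 ^ i) = Fract (\<Sum>i<k. p ^ i) 1"
proof -
  have "Fract p 1 ^ i = Fract (p ^ i) 1" for i
    by (induction i) (simp_all add: One_fract_def)
  then show ?thesis
    by (induction k) (simp_all add: Zero_fract_def)
qed

lemma Fract_1_eq_0_iff: "Fract p 1 = 0 \<longleftrightarrow> p = 0"
  by (simp add: Zero_fract_def eq_fract)

lemma q_fact_Fract_neq_0:
  assumes "\<And>k. 0 < k \<Longrightarrow> (\<Sum>i<k. p ^ i) \<noteq> 0"
  shows "q_fact (Fract p 1) n \<noteq> 0"
  using assms by (simp add: q_fact_def Fract_1_sum_power Fract_1_eq_0_iff)

text \<open>Evaluation at 1 gives \<open>k\<close>.\<close>

lemma sum_power_monom_neq_0: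
  assumes "0 < k"
  shows "(\<Sum>i<k. [:0, 1:] ^ i) \<noteq> (0 :: rat poly)"
proof
  assume "(\<Sum>i<k. [:0, 1:] ^ i) = (0 :: rat poly)"
  then have "poly (\<Sum>i<k. [:0, 1:] ^ i) (1 :: rat) = 0"
    by simp
  then show False
    using assms by (simp add: poly_sum)
qed

text \<open>Setting the outer variable to 0 reduces nonvanishing to the case of one
  variable.\<close>

lemma q_fact_q_rat_dvd_1: "q_fact q_rat n dvd 1"
proof -
  have "(\<Sum>i<k. [:[:0, 1:]:] ^ i) \<noteq> (0 :: rat poly poly)" if "0 < k" for k
  proof
    assume "(\<Sum>i<k. [:[:0, 1:]:] ^ i) = (0 :: rat poly poly)"
    then have "poly (\<Sum>i<k. [:[:0, 1:]:] ^ i) (0 :: rat poly) = 0"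
      by simp
    then show False
      using sum_power_monom_neq_0[OF that] by (simp add: poly_sum)
  qed
  then show ?thesis
    unfolding q_rat_def by (simp add: q_fact_Fract_neq_0 dvd_field_iff)
qed

text \<open>The q-factorial is a constant series with nonzero value in a field.\<close>

lemma q_fact_q_ser_dvd_1: "q_fact q_ser n dvd 1"
proof -
  have "q_fact (fps_const a) n = fps_const (q_fact a n)" for a :: "rat poly fract"
  proof -
    have "(\<Sum>i<k. fps_const a ^ i) = fps_const (\<Sum>i<k. a ^ i)" for k
      by (induction k) simp_all
    then show ?thesis
      by (induction n) (simp_all add: q_fact_Suc del: sum.lessThan_Suc)
  qed
  then show ?thesis
    unfolding q_ser_def
    by (simp add: fps_is_unit_iff q_fact_Fract_neq_0 sum_power_monom_neq_0)
qed

lemma t_rat_neq: "1 + t_rat ^ 2 \<noteq> 0" "1 - t_rat ^ 2 \<noteq> 0"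
  by (simp_all add: t_rat_def power2_eq_square One_fract_def Zero_fract_def eq_fract one_pCons)

text \<open>Writing s for \<open>sqrt_ser\<close>, t v = 1 - s and s^2 = 1 - t^2 give t^2 + (1 -
  s)^2 = 2 (1 - s), from which one factor t cancels. This is the substitution t = 2 v / (1 + v^2)
  linking the two identities.\<close>

lemma v_ser_relation: "t_ser * (1 + v_ser ^ 2) = 2 * v_ser"
proof -
  have "t_ser * (t_ser * (1 + v_ser ^ 2)) = t_ser * (2 * v_ser)"
    using t_times_v_ser sqrt_ser_square by algebra
  moreover have "t_ser \<noteq> 0"
    by (simp add: t_ser_def)
  ultimately show ?thesis
    by simp
qed

lemma v_ser_nth_0: "fps_nth v_ser 0 = 0"
  using arg_cong[OF v_ser_relation, of "\<lambda>f. fps_nth f 0"] by (simp add: t_ser_def fps_mult_nth_0 numeral_fps_const)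

theorem theorem4p14:
  shows
    "(let q = q_rat; t = t_rat in
       (fps_const (1 - t) * (1 + fps_const t * exp_q q)) /
         (1 - fps_const (t ^ 2) * exp_q q * Exp_q q)
       = 1 + fps_const ((1 + t) / 2) *
           Abs_fps (\<lambda>n. if n = 0 then 0 else
             ((1 + t ^ 2) / (1 - t ^ 2)) ^ n *
               P_inv_udr n q (2 * t / (1 + t ^ 2)) / q_fact q n))
     \<and>
     (let q = q_ser; t = t_ser; v = v_ser;
          y = fps_const ((1 - v ^ 2) / (1 + v ^ 2)) * fps_X in
       Abs_fps (\<lambda>n. if n = 0 then 0 else P_inv_udr n q t / q_fact q n)
       = fps_const (2 / (1 + v)) *
           ((fps_const (1 - v) * (1 + fps_const v * (exp_q q oo y))) /
              (1 - fps_const (v ^ 2) * (exp_q q oo y) * (Exp_q q oo y))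
            - 1))"
  unfolding Let_def
proof (intro conjI)
  define u where "u = (1 + t_rat ^ 2) / (1 - t_rat ^ 2)"
  define t where "t = 2 * t_rat / (1 + t_rat ^ 2)"
  let ?S = "Abs_fps (\<lambda>n. if n = 0 then 0 else u ^ n * P_inv_udr n q_rat t / q_fact q_rat n)"
  let ?N = "fps_const (1 - t_rat) * (1 + fps_const t_rat * exp_q q_rat)"
  let ?D = "1 - fps_const (t_rat ^ 2) * exp_q q_rat * Exp_q q_rat"
  have "u = 1 + t_rat * (u * t)" "u * t = t_rat * (1 + u)"
    by (rule run_weight_relations[of t_rat]; use t_rat_neq in \<open>simp add: u_def t_def\<close>)+
  note code_egf_run_weight[OF q_fact_q_rat_dvd_1 this]
  moreover have "code_egf q_rat (run_weight u (u * t)) = 1 + ?S"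
    by (rule fps_ext) (auto simp: code_egf_def code_sum_run_weight)
  ultimately have "(fps_const (1 - t_rat) + fps_const (1 + t_rat) * (1 + ?S)) * ?D = 2 * ?N"
    by (simp only:)
  \<comment> \<open>As (1 - t) + (1 + t) = 2, extracting 2 produces the leading 1 and the factor (1
    + t) / 2.\<close>
  moreover have "fps_const (1 - t_rat) + fps_const (1 + t_rat) * (1 + ?S) =
      2 * (1 + fps_const ((1 + t_rat) / 2) * ?S)"
  proof -
    have "fps_const (1 - t_rat) + fps_const (1 + t_rat) = 2"
      by (simp add: numeral_fps_const)
    moreover have "fps_const (1 + t_rat) = 2 * fps_const ((1 + t_rat) / 2)"
      by (simp add: numeral_fps_const add_divide_distrib)
    moreover have "a + b * (1 + s) = 2 * (1 + c * s)" if "a + b = 2" "b = 2 * c"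
      for a b c s :: "rat poly poly fract fps"
    proof -
      have "a + b * (1 + s) = (a + b) + b * s"
        by (simp only: distrib_left mult_1_right add.assoc)
      also have "\<dots> = 2 + 2 * c * s"
        by (simp only: that(1)) (simp only: that(2))
      finally show ?thesis
        by (simp only: distrib_left mult_1_right mult.assoc)
    qed
    ultimately show ?thesis
      by blast
  qed
  ultimately have "2 * ((1 + fps_const ((1 + t_rat) / 2) * ?S) * ?D) = 2 * ?N"
    by (simp only: mult.assoc)
  moreover have "(2 :: rat poly poly fract fps) \<noteq> 0"
    by (simp add: numeral_fps_const)
  ultimately have "(1 + fps_const ((1 + t_rat) / 2) * ?S) * ?D = ?N"
    using mult_left_cancel by blast
  \<comment> \<open>The constant coefficient is 1 - t^2.\<close>
  moreover have "fps_nth ?D 0 \<noteq> 0"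
    using t_rat_neq by (simp add: exp_q_def Exp_q_def binomial_eq_0)
  then have "?D \<noteq> 0"
    by (rule fps_nonzeroI)
  ultimately show "?N / ?D = 1 + fps_const ((1 + t_rat) / 2) * ?S"
    using nonzero_mult_div_cancel_right[of ?D "1 + fps_const ((1 + t_rat) / 2) * ?S"] by simp
next
  \<comment> \<open>The scaling of \<open>x\<close> is the inverse of \<open>u\<close>, shown below
    as \<open>cu\<close>.\<close>
  define c where "c = (1 - v_ser ^ 2) / (1 + v_ser ^ 2)"
  define u where "u = (1 + v_ser ^ 2) / (1 - v_ser ^ 2)"
  define y where "y = fps_const c * fps_X"
  let ?S = "Abs_fps (\<lambda>n. if n = 0 then 0 else P_inv_udr n q_ser t_ser / q_fact q_ser n)"
  let ?E = "exp_q q_ser oo y" and ?F = "Exp_q q_ser oo y"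
  let ?N = "fps_const (1 - v_ser) * (1 + fps_const v_ser * ?E)"
  let ?D = "1 - fps_const (v_ser ^ 2) * ?E * ?F"
  have units: "1 + v_ser ^ 2 dvd 1" "1 - v_ser ^ 2 dvd 1" "1 + v_ser dvd 1"
    by (simp_all add: fps_is_unit_iff v_ser_nth_0 power2_eq_square)
  then have c: "c * (1 + v_ser ^ 2) = 1 - v_ser ^ 2" and u: "u * (1 - v_ser ^ 2) = 1 + v_ser ^ 2"
    and v: "2 / (1 + v_ser) * (1 + v_ser) = 2"
    unfolding c_def u_def by (blast intro: dvd_div_mult_self unit_imp_dvd)+
  have nonzero: "1 + v_ser ^ 2 \<noteq> 0" "1 - v_ser ^ 2 \<noteq> 0" "1 + v_ser \<noteq> 0"
    using units by (metis not_is_unit_0)+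
  note weights = run_weight_relations[OF nonzero(2) u v_ser_relation]
  have "(1 - v_ser ^ 2) * (1 + v_ser ^ 2) * (c * u) = (1 - v_ser ^ 2) * (1 + v_ser ^ 2) * 1"
    using u c by algebra
  then have cu: "c * u = 1"
    using nonzero by simp
  let ?G = "code_egf q_ser (run_weight u (u * t_ser))"
  have y0: "fps_nth y 0 = 0"
    by (simp add: y_def)
  \<comment> \<open>Substituting \<open>c\<close> times \<open>x\<close> multiplies the coefficient
    of x^n by c^n, which cancels u^n.\<close>
  have G: "?G oo y = 1 + ?S"
  proof (rule fps_ext)
    fix n
    have "fps_nth (?G oo y) n = c ^ n * (u ^ n * P_inv_udr n q_ser t_ser / q_fact q_ser n)"
      by (simp add: y_def fps_compose_linear code_egf_def code_sum_run_weight)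
    also have "\<dots> = (c * u) ^ n * P_inv_udr n q_ser t_ser / q_fact q_ser n"
      using divide_unit(1)[OF q_fact_q_ser_dvd_1[of n], of "u ^ n * P_inv_udr n q_ser t_ser"]
        divide_unit(1)[OF q_fact_q_ser_dvd_1[of n], of "(c * u) ^ n * P_inv_udr n q_ser t_ser"]
      by (simp only: power_mult_distrib mult.assoc)
    finally show "fps_nth (?G oo y) n = fps_nth (1 + ?S) n"
      by (simp add: cu)
  qed
  \<comment> \<open>Composition with \<open>y\<close> respects sums and products because
    \<open>y\<close> has no constant term, so it carries the functional equation over.\<close>
  have "((fps_const (1 - v_ser) + fps_const (1 + v_ser) * ?G) *
        (1 - fps_const (v_ser ^ 2) * exp_q q_ser * Exp_q q_ser)) oo y =
      (fps_const 2 * (fps_const (1 - v_ser) * (1 + fps_const v_ser * exp_q q_ser))) oo y"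
    using code_egf_run_weight[OF q_fact_q_ser_dvd_1 weights] by (simp only: numeral_fps_const)
  then have 3: "(fps_const (1 - v_ser) + fps_const (1 + v_ser) * (1 + ?S)) * ?D = 2 * ?N"
    by (simp only: fps_compose_mult_distrib[OF y0] fps_compose_add_distrib fps_compose_sub_distrib
        fps_const_compose fps_compose_1 G numeral_fps_const)
  \<comment> \<open>The coefficient of x^0 is 1 - v^2, a series in t with constant term 1, so the
    division is exact.\<close>
  have D0: "fps_nth (fps_nth ?D 0) 0 \<noteq> 0"
    by (simp add: exp_q_def Exp_q_def binomial_eq_0 v_ser_nth_0 power2_eq_square)
  then have 4: "?N / ?D * ?D = ?N"
    by (rule fps_fps_divide_times)
  have "?D \<noteq> 0"
    by (rule fps_nonzeroI, rule fps_nonzeroI, rule D0)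
  have "fps_const (1 - v_ser) + fps_const (1 + v_ser) = 2"
    by (simp add: numeral_fps_const)
  then have "2 + fps_const (1 + v_ser) * ?S = fps_const (1 - v_ser) + fps_const (1 + v_ser) * (1 + ?S)"
    by (simp only: distrib_left mult_1_right add.assoc[symmetric])
  then have "(2 + fps_const (1 + v_ser) * ?S) * ?D = 2 * ?N"
    by (simp only: 3)
  also have "\<dots> = (2 * (?N / ?D)) * ?D"
    by (simp only: 4 mult.assoc[of 2 "?N / ?D" ?D])
  finally have 5: "2 + fps_const (1 + v_ser) * ?S = 2 * (?N / ?D)"
    using \<open>?D \<noteq> 0\<close> by (simp only: mult_cancel_right) simp
  have "fps_const (1 + v_ser) * fps_const (2 / (1 + v_ser)) = 2"
    unfolding fps_const_mult mult.commute[of "1 + v_ser"] v by (simp add: numeral_fps_const)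
  then have "fps_const (1 + v_ser) * (fps_const (2 / (1 + v_ser)) * (?N / ?D - 1)) =
      2 * (?N / ?D - 1)"
    by (simp only: mult.assoc[symmetric])
  also have "\<dots> = fps_const (1 + v_ser) * ?S"
    by (simp only: right_diff_distrib 5[symmetric]) simp
  finally have "fps_const (1 + v_ser) * ?S =
      fps_const (1 + v_ser) * (fps_const (2 / (1 + v_ser)) * (?N / ?D - 1))" ..
  then have "?S = fps_const (2 / (1 + v_ser)) * (?N / ?D - 1)"
    using nonzero by simp
  then show "?S = fps_const (2 / (1 + v_ser)) *
      ((fps_const (1 - v_ser) * (1 + fps_const v_ser * (exp_q q_ser oo
          fps_const ((1 - v_ser ^ 2) / (1 + v_ser ^ 2)) * fps_X))) /
        (1 - fps_const (v_ser ^ 2) *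
          (exp_q q_ser oo fps_const ((1 - v_ser ^ 2) / (1 + v_ser ^ 2)) * fps_X) *
          (Exp_q q_ser oo fps_const ((1 - v_ser ^ 2) / (1 + v_ser ^ 2)) * fps_X)) - 1)"
    unfolding y_def c_def .
qed

end
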